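(* Let $d\ge 1$ be an integer. For every real number $\alpha\in\left(1-\frac1d,1\right]$ there exists a real number $\beta=\beta(\alpha)>0$ such that, for every positive integer $n$ and every family $\mathcal{F}$ of $n$ axis-parallel boxes in $\mathbb{R}^d$, if at least $\alpha\binom n2$ of the pairs of elements of $\mathcal{F}$ are intersecting, then $\mathcal{F}$ has an intersecting subfamily of cardinality at least $\beta n$.
   Context: An axis-parallel box (or box) in $\mathbb{R}^d$ is a product of $d$ bounded intervals, either all open, $(a_1,b_1)\times\cdots\times(a_d,b_d)$, or all closed, $[a_1,b_1]\times\cdots\times[a_d,b_d]$, with $a_i<b_i$ for all $i$. The statement holds both when the boxes of the family are open and when they are closed. A subfamily is intersecting if there is a point of $\mathbb{R}^d$ belonging to all of its elements; a pair of boxes is intersecting if the two boxes have nonempty intersection. The number $\beta$ may depend on $\alpha$ and $d$ but not on $n$ or $\mathcal{F}$. *)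

theory Defs
  imports "HOL-Analysis.Analysis"
begin

definition open_box :: "(real ^ 'd) set \<Rightarrow> bool" where
  "open_box B \<longleftrightarrow> (\<exists>a b. (\<forall>i. a $ i < b $ i) \<and> B = box a b)"

definition closed_box :: "(real ^ 'd) set \<Rightarrow> bool" where
  "closed_box B \<longleftrightarrow> (\<exists>a b. (\<forall>i. a $ i < b $ i) \<and> B = cbox a b)"

text \<open>
  A family of \<open>n\<close> boxes is indexed by \<open>{..<n}\<close>, so that the same box may occur repeatedly (the
  injective \<open>F\<close> are the families without repetition); pairs, subfamilies and cardinalities refer
  to indices. The boxes of a family are all open or all closed.
\<close>

definition box_family :: "nat \<Rightarrow> (nat \<Rightarrow> (real ^ 'd) set) \<Rightarrow> bool" where
  "box_family n F \<longleftrightarrow> (\<forall>i<n. open_box (F i)) \<or> (\<forall>i<n. closed_box (F i))"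

definition intersecting_pairs :: "nat \<Rightarrow> (nat \<Rightarrow> 'a set) \<Rightarrow> (nat \<times> nat) set" where
  "intersecting_pairs n F = {(i, j). i < j \<and> j < n \<and> F i \<inter> F j \<noteq> {}}"

definition intersecting_subfamily :: "nat \<Rightarrow> (nat \<Rightarrow> 'a set) \<Rightarrow> nat set \<Rightarrow> bool" where
  "intersecting_subfamily n F I \<longleftrightarrow> I \<subseteq> {..<n} \<and> (\<exists>x. \<forall>i\<in>I. x \<in> F i)"

end

theory Submission
  imports Defs
begin

text \<open>
  Let \<open>d\<close> be the dimension and call two boxes related when they meet. The proof has two halves.

  \<^item> \<^emph>\<open>Many \<open>(d+1)\<close>-tuples are cliques.\<close> Since the density of related pairs exceeds the Turan
    threshold \<open>1 - 1/d\<close>, supersaturation yields a positive proportion of pairwise related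
    \<open>(d+1)\<close>-tuples. This is proved by the inequality of Moon and Moser (\<open>moon_moser\<close>), which
    bounds the ratio of the numbers of \<open>(k+1)\<close>-cliques and \<open>k\<close>-cliques from below in terms of the
    previous ratio; iterated, it shows that this ratio is at least \<open>(1 - k (1 - \<alpha>)) n\<close>, where
    \<open>1 - k (1 - \<alpha>)\<close> is positive for all \<open>k \<le> d\<close> because \<open>d (1 - \<alpha>) < 1\<close>. Tuples are lists in which repetitions are
    allowed, and every box is related to itself, so the count has no lower order terms and small
    \<open>n\<close> needs no separate treatment.

  \<^item> \<^emph>\<open>One point is charged by many boxes.\<close> The lower corner of the intersection of \<open>d + 1\<close> boxes
    has \<open>d\<close> coordinates, each of which is the lower bound of one of the boxes. So one of the boxes
    can be dropped without changing that corner (\<open>exists_dominated_entry\<close>). There are at most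
    \<open>n ^ d\<close> tuples of length \<open>d\<close> to which the cliques are charged in this way, so one of them is
    charged by a positive proportion of all boxes, and its lower corner lies in all of these if
    they are closed. If they are open, the corner lies strictly below all their upper bounds, and
    a point slightly above it in every coordinate lies in all of them.
\<close>

section \<open>Removing and inserting list entries\<close>

definition delete_at :: "nat \<Rightarrow> 'a list \<Rightarrow> 'a list" where
  "delete_at i xs = take i xs @ drop (Suc i) xs"

definition insert_at :: "nat \<Rightarrow> 'a \<Rightarrow> 'a list \<Rightarrow> 'a list" where
  "insert_at i x xs = take i xs @ x # drop i xs"

lemma length_delete_at: "i < length xs \<Longrightarrow> length (delete_at i xs) = length xs - 1"
  by (simp add: delete_at_def)

lemma length_insert_at [simp]: "length (insert_at i x xs) = Suc (length xs)"
  by (simp add: insert_at_def)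

lemma set_insert_at [simp]: "set (insert_at i x xs) = insert x (set xs)"
  using append_take_drop_id[of i xs] unfolding insert_at_def
  by (metis Un_insert_right list.simps(15) set_append)

lemma insert_delete_at: "i < length xs \<Longrightarrow> insert_at i (xs ! i) (delete_at i xs) = xs"
  by (simp add: insert_at_def delete_at_def id_take_nth_drop[symmetric])

lemma delete_insert_at: "i \<le> length xs \<Longrightarrow> delete_at i (insert_at i x xs) = xs"
  by (simp add: insert_at_def delete_at_def)

lemma nth_insert_at: "i \<le> length xs \<Longrightarrow> insert_at i x xs ! i = x"
  by (simp add: insert_at_def nth_append)

lemma set_delete_at_subset: "set (delete_at i xs) \<subseteq> set xs"
  unfolding delete_at_def using set_take_subset[of i xs] set_drop_subset[of "Suc i" xs] by auto

lemma nth_in_delete_at: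
  assumes "i < length xs" "j < length xs" "j \<noteq> i"
  shows "xs ! j \<in> set (delete_at i xs)"
proof (cases "j < i")
  case True
  then have "xs ! j \<in> set (take i xs)"
    using assms by (auto simp: in_set_conv_nth intro!: exI[of _ j])
  then show ?thesis by (simp add: delete_at_def)
next
  case False
  then have "drop (Suc i) xs ! (j - Suc i) = xs ! j" "j - Suc i < length (drop (Suc i) xs)"
    using assms by auto
  then have "xs ! j \<in> set (drop (Suc i) xs)"
    by (metis nth_mem)
  then show ?thesis by (simp add: delete_at_def)
qed


section \<open>Supersaturation for cliques\<close>

locale finite_tolerance =
  fixes V :: "'a set" and R :: "'a \<Rightarrow> 'a \<Rightarrow> bool"
  assumes finite_V: "finite V" and V_nonempty: "V \<noteq> {}"
    and refl: "x \<in> V \<Longrightarrow> R x x" and sym: "R x y \<Longrightarrow> R y x"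
begin

definition cliques :: "nat \<Rightarrow> 'a list set" where
  "cliques k = {xs. length xs = k \<and> set xs \<subseteq> V \<and> (\<forall>x\<in>set xs. \<forall>y\<in>set xs. R x y)}"

definition extensions :: "'a list \<Rightarrow> 'a set" where
  "extensions xs = {v \<in> V. \<forall>x\<in>set xs. R v x}"

lemma finite_extensions: "finite (extensions xs)"
  using finite_V by (simp add: extensions_def)

lemma finite_cliques: "finite (cliques k)"
  by (rule finite_subset[OF _ finite_lists_length_eq[OF finite_V, of k]])
     (auto simp: cliques_def)

lemma card_cliques_le: "card (cliques k) \<le> card V ^ k"
proof -
  have "card (cliques k) \<le> card {xs. set xs \<subseteq> V \<and> length xs = k}"
    by (rule card_mono[OF finite_lists_length_eq[OF finite_V]]) (auto simp: cliques_def)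
  then show ?thesis by (simp add: card_lists_length_eq[OF finite_V])
qed

lemma cliques_nonempty: "cliques k \<noteq> {}"
proof -
  obtain x where "x \<in> V" using V_nonempty by blast
  then have "replicate k x \<in> cliques k" by (auto simp: cliques_def refl)
  then show ?thesis by blast
qed

lemma card_cliques_pos: "0 < card (cliques k)"
  using cliques_nonempty finite_cliques by (simp add: card_gt_0_iff)

lemma insert_at_in_cliques:
  assumes "ys \<in> cliques k" "x \<in> extensions ys"
  shows "insert_at i x ys \<in> cliques (Suc k)"
  using assms by (auto simp: cliques_def extensions_def intro: refl sym)

lemma delete_at_in_cliques:
  assumes "xs \<in> cliques (Suc k)" "i \<le> k"
  shows "delete_at i xs \<in> cliques k" "xs ! i \<in> extensions (delete_at i xs)"
proof -
  have "xs ! i \<in> set xs" using assms by (auto simp: cliques_def)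
  then show "delete_at i xs \<in> cliques k" "xs ! i \<in> extensions (delete_at i xs)"
    using assms set_delete_at_subset[of i xs]
    by (auto simp: cliques_def extensions_def length_delete_at subset_iff)
qed

text \<open>
  Splitting off the \<open>i\<close>-th entry identifies the \<open>(k+1)\<close>-cliques with the pairs of a \<open>k\<close>-clique
  and one of its extensions; being a clique depends only on the set of entries, so the position
  \<open>i\<close> does not affect the right hand side.
\<close>
lemma sum_cliques_delete_at:
  fixes f :: "'a list \<Rightarrow> real"
  assumes "i \<le> k"
  shows "(\<Sum>xs\<in>cliques (Suc k). f (delete_at i xs))
       = (\<Sum>ys\<in>cliques k. f ys * card (extensions ys))"
proof -
  have "(\<Sum>xs\<in>cliques (Suc k). f (delete_at i xs))
      = (\<Sum>(ys, x)\<in>(SIGMA ys:cliques k. extensions ys). f ys)"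
  proof (rule sum.reindex_bij_witness[where i = "\<lambda>(ys, x). insert_at i x ys"
        and j = "\<lambda>xs. (delete_at i xs, xs ! i)"])
    fix xs assume "xs \<in> cliques (Suc k)"
    then have "i < length xs" using assms by (simp add: cliques_def)
    then show "(case (delete_at i xs, xs ! i) of (ys, x) \<Rightarrow> insert_at i x ys) = xs"
      by (simp add: insert_delete_at)
  next
    fix p assume "p \<in> (SIGMA ys:cliques k. extensions ys)"
    moreover obtain ys x where p: "p = (ys, x)" by fastforce
    ultimately have "ys \<in> cliques k" "x \<in> extensions ys" by auto
    moreover from this have "i \<le> length ys" using assms by (simp add: cliques_def)
    ultimately show "(delete_at i (case p of (ys, x) \<Rightarrow> insert_at i x ys),
        (case p of (ys, x) \<Rightarrow> insert_at i x ys) ! i) = p"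
      "(case p of (ys, x) \<Rightarrow> insert_at i x ys) \<in> cliques (Suc k)"
      by (simp_all add: p delete_insert_at nth_insert_at insert_at_in_cliques)
  qed (use assms in \<open>auto intro: delete_at_in_cliques\<close>)
  also have "\<dots> = (\<Sum>ys\<in>cliques k. \<Sum>x\<in>extensions ys. f ys)"
    by (rule sum.Sigma[symmetric]) (auto simp: finite_cliques finite_extensions)
  finally show ?thesis by (simp add: mult.commute)
qed

lemma card_cliques_Suc:
  "real (card (cliques (Suc k))) = (\<Sum>ys\<in>cliques k. real (card (extensions ys)))"
  using sum_cliques_delete_at[of 0 k "\<lambda>_. 1"] by simp

text \<open>
  A point unrelated to the entry at position \<open>j\<close> can extend the list only after that entry has
  been deleted, so it is counted at most once on the left; any other point is counted at most
  \<open>k + 1\<close> times.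
\<close>
lemma sum_extensions_delete_at:
  assumes "length xs = Suc k"
  shows "(\<Sum>i\<le>k. real (card (extensions (delete_at i xs))))
       \<le> real (card V) + real k * card (extensions xs)"
proof -
  have *: "(\<Sum>i\<le>k. indicator (extensions (delete_at i xs)) v)
      \<le> 1 + real k * indicator (extensions xs) v" if v: "v \<in> V" for v
  proof (cases "v \<in> extensions xs")
    case True
    have "(\<Sum>i\<le>k. indicator (extensions (delete_at i xs)) v) \<le> (\<Sum>i\<le>k. 1::real)"
      by (rule sum_mono) (simp add: indicator_def)
    then show ?thesis using True by simp
  next
    case False
    then obtain x where "x \<in> set xs" "\<not> R v x"
      using v by (auto simp: extensions_def)
    then obtain j where j: "j \<le> k" "\<not> R v (xs ! j)"
      using assms by (auto simp: in_set_conv_nth less_Suc_eq_le)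
    have "(\<Sum>i\<le>k. indicator (extensions (delete_at i xs)) v) \<le> (\<Sum>i\<le>k. if i = j then 1 else 0::real)"
    proof (rule sum_mono)
      fix i assume "i \<in> {..k}"
      then have "i \<noteq> j \<Longrightarrow> xs ! j \<in> set (delete_at i xs)"
        using j assms by (intro nth_in_delete_at) auto
      then show "indicator (extensions (delete_at i xs)) v \<le> (if i = j then 1 else 0::real)"
        using j by (auto simp: extensions_def indicator_def)
    qed
    then show ?thesis using False j by simp
  qed
  have card_eq: "real (card (extensions ys)) = (\<Sum>v\<in>V. indicator (extensions ys) v)" for ys
  proof -
    have "extensions ys \<subseteq> V" by (auto simp: extensions_def)
    then show ?thesis using finite_V
      by (simp add: indicator_def of_bool_def sum.If_cases Int_absorb1 Int_def[symmetric])
  qed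
  have "(\<Sum>i\<le>k. real (card (extensions (delete_at i xs))))
      = (\<Sum>v\<in>V. \<Sum>i\<le>k. indicator (extensions (delete_at i xs)) v)"
    unfolding card_eq by (rule sum.swap)
  also have "\<dots> \<le> (\<Sum>v\<in>V. 1 + real k * indicator (extensions xs) v)"
    by (rule sum_mono) (rule *)
  also have "\<dots> = real (card V) + real k * card (extensions xs)"
    unfolding card_eq by (simp add: sum.distrib sum_distrib_left)
  finally show ?thesis .
qed

text \<open>
  Summing the previous bound over all \<open>(k+1)\<close>-cliques turns the left hand side into \<open>k + 1\<close> times
  the sum of the squared numbers of extensions of the \<open>k\<close>-cliques, which Cauchy-Schwarz compares
  with the square of their sum.
\<close>
lemma moon_moser:
  "real (Suc k) * (real (card (cliques (Suc k))))\<^sup>2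
   \<le> real (card (cliques k)) *
      (real (card V) * card (cliques (Suc k)) + real k * card (cliques (Suc (Suc k))))"
proof -
  define S where "S = (\<Sum>ys\<in>cliques k. (real (card (extensions ys)))\<^sup>2)"
  have "real (Suc k) * S = (\<Sum>i\<le>k. \<Sum>xs\<in>cliques (Suc k). real (card (extensions (delete_at i xs))))"
    using sum_cliques_delete_at[where f = "\<lambda>ys. real (card (extensions ys))" and k = k]
    by (simp add: S_def power2_eq_square)
  also have "\<dots> = (\<Sum>xs\<in>cliques (Suc k). \<Sum>i\<le>k. real (card (extensions (delete_at i xs))))"
    by (rule sum.swap)
  also have "\<dots> \<le> (\<Sum>xs\<in>cliques (Suc k). real (card V) + real k * card (extensions xs))"
    by (rule sum_mono, rule sum_extensions_delete_at) (simp add: cliques_def)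
  also have "\<dots> = real (card V) * card (cliques (Suc k)) + real k * card (cliques (Suc (Suc k)))"
    by (simp add: sum.distrib card_cliques_Suc[of "Suc k"] sum_distrib_left)
  finally have upper: "real (Suc k) * S
    \<le> real (card V) * card (cliques (Suc k)) + real k * card (cliques (Suc (Suc k)))" .
  have "(real (card (cliques (Suc k))))\<^sup>2 \<le> S * card (cliques k)"
    unfolding card_cliques_Suc S_def
    by (rule sum_squared_le_sum_of_squares)
  then have "real (Suc k) * (real (card (cliques (Suc k))))\<^sup>2 \<le> card (cliques k) * (real (Suc k) * S)"
    using mult_left_mono[of _ _ "real (Suc k)"] by (simp add: mult_ac)
  also have "\<dots> \<le> card (cliques k) *
      (real (card V) * card (cliques (Suc k)) + real k * card (cliques (Suc (Suc k))))"
    by (rule mult_left_mono[OF upper]) simp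
  finally show ?thesis .
qed

lemma cliques_ratio:
  assumes "(1 - q) * (real (card V))\<^sup>2 \<le> card (cliques 2)" and "1 \<le> k"
  shows "(1 - real k * q) * (real (card V) * card (cliques k)) \<le> card (cliques (Suc k))"
  using \<open>1 \<le> k\<close>
proof (induction k rule: dec_induct)
  case base
  have "cliques 0 = {[]}" by (auto simp: cliques_def)
  then have "card (cliques 1) = card V"
    using card_cliques_Suc[of 0] by (simp add: extensions_def)
  then show ?case using assms(1) by (simp add: power2_eq_square numeral_2_eq_2)
next
  case (step k)
  define n a b c where "n = real (card V)" and "a = real (card (cliques k))"
    and "b = real (card (cliques (Suc k)))" and "c = real (card (cliques (Suc (Suc k))))"
  have pos: "a > 0" "b > 0" using card_cliques_pos by (simp_all add: a_def b_def)
  have "real (Suc k) * b\<^sup>2 \<le> a * (n * b + real k * c)"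
    using moon_moser[of k] by (simp add: n_def a_def b_def c_def)
  moreover have "real (Suc k) * b * ((1 - real k * q) * (n * a)) \<le> real (Suc k) * b * b"
    using step.IH pos by (intro mult_left_mono) (simp_all add: n_def a_def b_def)
  ultimately have "a * (real (Suc k) * b * (1 - real k * q) * n) \<le> a * (n * b + real k * c)"
    by (simp add: power2_eq_square mult_ac)
  then have "real (Suc k) * b * (1 - real k * q) * n \<le> n * b + real k * c"
    using pos by simp
  then have "real k * ((1 - real (Suc k) * q) * (n * b)) \<le> real k * c"
    by (simp add: algebra_simps)
  then show ?case using step.hyps by (simp add: n_def b_def c_def)
qed

lemma card_cliques_ge:
  assumes "(1 - q) * (real (card V))\<^sup>2 \<le> card (cliques 2)" and "real k * q < 1" and "0 \<le> q"
  shows "(\<Prod>j=1..k. 1 - real j * q) * real (card V) ^ Suc k \<le> card (cliques (Suc k))"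
  using \<open>real k * q < 1\<close>
proof (induction k)
  case 0
  have "cliques 0 = {[]}" by (auto simp: cliques_def)
  then show ?case using card_cliques_Suc[of 0] by (simp add: extensions_def)
next
  case (Suc k)
  have "real k * q < 1" using Suc.prems \<open>0 \<le> q\<close> by (simp add: algebra_simps)
  then have IH: "(\<Prod>j=1..k. 1 - real j * q) * real (card V) ^ Suc k \<le> card (cliques (Suc k))"
    by (rule Suc.IH)
  have "(\<Prod>j=1..Suc k. 1 - real j * q) * real (card V) ^ Suc (Suc k)
      = (1 - real (Suc k) * q) * (real (card V) * ((\<Prod>j=1..k. 1 - real j * q) * real (card V) ^ Suc k))"
    by (simp add: mult_ac)
  also have "\<dots> \<le> (1 - real (Suc k) * q) * (real (card V) * card (cliques (Suc k)))"
    using Suc.prems by (intro mult_left_mono IH) auto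
  also have "\<dots> \<le> card (cliques (Suc (Suc k)))"
    by (rule cliques_ratio[OF assms(1)]) simp
  finally show ?case .
qed

end


section \<open>Charging cliques to lower corners\<close>

text \<open>
  For each of the \<open>d\<close> coordinates choose a position where the coordinate is largest; some position
  is never chosen.
\<close>
lemma exists_dominated_entry:
  fixes a :: "'a \<Rightarrow> real ^ 'd::finite"
  assumes "length xs = Suc CARD('d)"
  shows "\<exists>i\<le>CARD('d). \<forall>c. \<exists>y\<in>set (delete_at i xs). a (xs ! i) $ c \<le> a y $ c"
proof -
  have "\<exists>j\<le>CARD('d). \<forall>i\<le>CARD('d). a (xs ! i) $ c \<le> a (xs ! j) $ c" for c
  proof -
    let ?A = "(\<lambda>j. a (xs ! j) $ c) ` {..CARD('d)}"
    have "Max ?A \<in> ?A" by (rule Max_in) auto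
    then obtain j where "Max ?A = a (xs ! j) $ c" "j \<in> {..CARD('d)}" by (rule imageE)
    moreover have "a (xs ! i) $ c \<le> Max ?A" if "i \<le> CARD('d)" for i
      using that by (intro Max_ge) auto
    ultimately show ?thesis by auto
  qed
  then obtain g where g: "\<And>c. g c \<le> CARD('d)"
    "\<And>c i. i \<le> CARD('d) \<Longrightarrow> a (xs ! i) $ c \<le> a (xs ! g c) $ c" by metis
  have "card (range g) \<le> CARD('d)" by (rule card_image_le) simp
  then have "card (range g) < card {..CARD('d)}" by simp
  then have "\<not> {..CARD('d)} \<subseteq> range g" by (meson card_mono finite finite_imageI not_le)
  then obtain i where i: "i \<le> CARD('d)" "i \<notin> range g" by auto
  have "xs ! g c \<in> set (delete_at i xs)" for c
    using i g(1)[of c] assms by (intro nth_in_delete_at) auto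
  with i g(2) show ?thesis by blast
qed

text \<open>
  The points \<open>a v\<close> play the role of the lower corners of the boxes: \<open>p\<close> is the lower corner of the
  intersection of a heavily charged clique, and \<open>I\<close> is the set of the boxes charged to it. That each coordinate of
  \<open>p\<close> is the lower bound of a box meeting \<open>v\<close> is what keeps \<open>p\<close> below the upper bounds of \<open>v\<close>.
\<close>
lemma (in finite_tolerance) heavily_charged_corner:
  fixes a :: "'a \<Rightarrow> real ^ 'd::finite" and \<delta> :: real
  assumes "\<delta> * real (card V) ^ Suc CARD('d) \<le> card (cliques (Suc CARD('d)))"
  shows "\<exists>I p. I \<subseteq> V \<and> \<delta> / real (Suc CARD('d)) * real (card V) \<le> card I \<and>
           (\<forall>v\<in>I. \<forall>c. a v $ c \<le> p $ c \<and> (\<exists>y\<in>V. R v y \<and> p $ c = a y $ c))"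
proof -
  let ?d = "CARD('d)"
  define D where "D ys = {v \<in> extensions ys. \<forall>c. \<exists>y\<in>set ys. a v $ c \<le> a y $ c}" for ys
  have fin: "finite (SIGMA ys:cliques ?d. D ys)"
    by (auto simp: D_def intro!: finite_SigmaI finite_cliques finite_extensions)
  have "cliques (Suc ?d)
      \<subseteq> (\<Union>i\<le>?d. (\<lambda>(ys, x). insert_at i x ys) ` (SIGMA ys:cliques ?d. D ys))"
  proof
    fix xs assume xs: "xs \<in> cliques (Suc ?d)"
    then have len: "length xs = Suc ?d" by (simp add: cliques_def)
    obtain i where i: "i \<le> ?d" "\<forall>c. \<exists>y\<in>set (delete_at i xs). a (xs ! i) $ c \<le> a y $ c"
      using exists_dominated_entry[OF len] by blast
    have "(delete_at i xs, xs ! i) \<in> (SIGMA ys:cliques ?d. D ys)"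
      using delete_at_in_cliques[OF xs i(1)] i(2) by (simp add: D_def)
    moreover have "xs = (\<lambda>(ys, x). insert_at i x ys) (delete_at i xs, xs ! i)"
      using i len by (simp add: insert_delete_at)
    ultimately show "xs \<in> (\<Union>i\<le>?d. (\<lambda>(ys, x). insert_at i x ys) ` (SIGMA ys:cliques ?d. D ys))"
      using i(1) by blast
  qed
  then have "card (cliques (Suc ?d))
      \<le> card (\<Union>i\<le>?d. (\<lambda>(ys, x). insert_at i x ys) ` (SIGMA ys:cliques ?d. D ys))"
    by (intro card_mono) (use fin in auto)
  also have "\<dots> \<le> (\<Sum>i\<le>?d. card ((\<lambda>(ys, x). insert_at i x ys) ` (SIGMA ys:cliques ?d. D ys)))"
    by (rule card_UN_le) simp
  also have "\<dots> \<le> (\<Sum>i\<le>?d. card (SIGMA ys:cliques ?d. D ys))"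
    by (intro sum_mono card_image_le fin)
  also have "\<dots> = Suc ?d * (\<Sum>ys\<in>cliques ?d. card (D ys))"
    by (simp add: card_SigmaI finite_cliques D_def finite_extensions)
  finally have "real (card (cliques (Suc ?d))) \<le> real (Suc ?d * (\<Sum>ys\<in>cliques ?d. card (D ys)))"
    by (simp only: of_nat_le_iff)
  with assms have "\<delta> * real (card V) ^ Suc ?d \<le> real (Suc ?d) * (\<Sum>ys\<in>cliques ?d. real (card (D ys)))"
    unfolding of_nat_mult of_nat_sum by (rule order_trans)
  then have charge: "\<delta> / real (Suc ?d) * real (card V) * real (card V) ^ ?d
      \<le> (\<Sum>ys\<in>cliques ?d. real (card (D ys)))"
    by (simp add: field_simps)
  obtain ys where ys: "ys \<in> cliques ?d" "\<delta> / real (Suc ?d) * real (card V) \<le> card (D ys)"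
  proof (rule ccontr)
    assume "\<not> thesis"
    then have small: "real (card (D ys)) < \<delta> / real (Suc ?d) * real (card V)" if "ys \<in> cliques ?d" for ys
      using that \<open>\<And>ys. _ \<Longrightarrow> _ \<Longrightarrow> thesis\<close> by (meson not_le)
    then have "0 < \<delta> / real (Suc ?d) * real (card V)"
      using cliques_nonempty by (meson equals0I le_less_trans of_nat_0_le_iff)
    have "(\<Sum>ys\<in>cliques ?d. real (card (D ys)))
        < (\<Sum>ys\<in>cliques ?d. \<delta> / real (Suc ?d) * real (card V))"
      by (intro sum_strict_mono finite_cliques cliques_nonempty small)
    also have "\<dots> = \<delta> / real (Suc ?d) * real (card V) * real (card (cliques ?d))"
      by simp
    also have "\<dots> \<le> \<delta> / real (Suc ?d) * real (card V) * real (card V) ^ ?d"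
      using \<open>0 < \<delta> / _ * _\<close> card_cliques_le[of ?d]
      by (intro mult_left_mono) (auto simp flip: of_nat_power)
    finally show False using charge by simp
  qed
  define p :: "real ^ 'd" where "p = (\<chi> c. Max ((\<lambda>y. a y $ c) ` set ys))"
  have "set ys \<noteq> {}" using ys(1) by (auto simp: cliques_def)
  then have "p $ c \<in> (\<lambda>y. a y $ c) ` set ys" for c
    unfolding p_def vec_lambda_beta by (intro Max_in) auto
  then have p_attained: "\<exists>y\<in>set ys. p $ c = a y $ c" for c
    by (simp add: image_iff)
  have p_ge: "a y $ c \<le> p $ c" if "y \<in> set ys" for y c
    using that by (simp add: p_def)
  have "a v $ c \<le> p $ c \<and> (\<exists>y\<in>V. R v y \<and> p $ c = a y $ c)" if "v \<in> D ys" for v c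
  proof
    show "a v $ c \<le> p $ c" using that p_ge by (force simp: D_def intro: order_trans)
    show "\<exists>y\<in>V. R v y \<and> p $ c = a y $ c"
      using that p_attained[of c] ys(1) by (auto simp: D_def extensions_def cliques_def)
  qed
  moreover have "D ys \<subseteq> V" by (auto simp: D_def extensions_def)
  ultimately show ?thesis using ys(2) by blast
qed


section \<open>Families of boxes\<close>

text \<open>
  Every index is counted once on the diagonal, so that at least \<open>\<alpha> n (n - 1) + n \<ge> \<alpha> n\<^sup>2\<close> ordered
  pairs are intersecting.
\<close>
lemma intersecting_ordered_pairs:
  fixes F :: "nat \<Rightarrow> 'a set" and \<alpha> :: real
  assumes "\<And>i. i < n \<Longrightarrow> F i \<noteq> {}" and "\<alpha> \<le> 1"
    and "\<alpha> * real (n choose 2) \<le> real (card (intersecting_pairs n F))"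
  shows "\<alpha> * (real n)\<^sup>2 \<le> card {(i, j). i < n \<and> j < n \<and> F i \<inter> F j \<noteq> {}}"
proof -
  let ?P = "intersecting_pairs n F" and ?D = "(\<lambda>i. (i, i)) ` {..<n}"
  have fin: "finite ?P"
    by (rule finite_subset[of _ "{..<n} \<times> {..<n}"]) (auto simp: intersecting_pairs_def)
  have "{(i, j). i < n \<and> j < n \<and> F i \<inter> F j \<noteq> {}} = ?P \<union> prod.swap ` ?P \<union> ?D"
  proof (intro equalityI subsetI)
    fix z assume "z \<in> {(i, j). i < n \<and> j < n \<and> F i \<inter> F j \<noteq> {}}"
    then obtain i j where z: "z = (i, j)" "i < n" "j < n" "F i \<inter> F j \<noteq> {}" by auto
    then consider "i < j" | "j < i" | "i = j" by linarith
    then show "z \<in> ?P \<union> prod.swap ` ?P \<union> ?D"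
    proof cases
      case 2
      then have "(j, i) \<in> ?P" using z by (auto simp: intersecting_pairs_def)
      then show ?thesis using z by force
    qed (use z in \<open>auto simp: intersecting_pairs_def\<close>)
  qed (use assms(1) in \<open>auto simp: intersecting_pairs_def\<close>)
  moreover have "card (?P \<union> prod.swap ` ?P \<union> ?D) = card (?P \<union> prod.swap ` ?P) + card ?D"
    using fin by (intro card_Un_disjoint) (auto simp: intersecting_pairs_def)
  moreover have "card (?P \<union> prod.swap ` ?P) = card ?P + card (prod.swap ` ?P)"
    using fin by (intro card_Un_disjoint) (auto simp: intersecting_pairs_def)
  moreover have "card (prod.swap ` ?P) = card ?P" by (rule card_image) simp
  moreover have "card ?D = n" by (subst card_image) (auto simp: inj_on_def)
  ultimately have card_eq: "card {(i, j). i < n \<and> j < n \<and> F i \<inter> F j \<noteq> {}} = 2 * card ?P + n"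
    by simp
  have "even (n * (n - 1))" by (cases n) auto
  then have "2 * (n choose 2) = n * (n - 1)"
    unfolding choose_two by (rule dvd_mult_div_cancel)
  then have "real (2 * (n choose 2)) = real (n * (n - 1))" by (simp only:)
  then have "2 * real (n choose 2) = real n * (real n - 1)"
    by (cases n) (simp_all add: algebra_simps)
  then have "(real n)\<^sup>2 = 2 * real (n choose 2) + real n"
    by (simp add: power2_eq_square algebra_simps)
  then have "\<alpha> * (real n)\<^sup>2 = 2 * (\<alpha> * real (n choose 2)) + \<alpha> * real n"
    by (simp only: distrib_left mult.left_commute)
  also have "\<dots> \<le> 2 * real (card ?P) + real n"
    using assms(2,3) mult_right_mono[of \<alpha> 1 "real n"] by simp
  finally show ?thesis by (simp add: card_eq)
qed

lemma closed_boxes_common_point: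
  fixes a b :: "nat \<Rightarrow> real ^ 'd::finite"
  assumes F: "\<And>i. i \<in> V \<Longrightarrow> F i = cbox (a i) (b i)" and "I \<subseteq> V"
    and corner: "\<And>v c. v \<in> I \<Longrightarrow> a v $ c \<le> p $ c \<and> (\<exists>y\<in>V. F v \<inter> F y \<noteq> {} \<and> p $ c = a y $ c)"
  shows "\<exists>x. \<forall>v\<in>I. x \<in> F v"
proof -
  have "p \<in> F v" if "v \<in> I" for v
  proof -
    have "p $ c \<le> b v $ c" for c
    proof -
      obtain y where "y \<in> V" "F v \<inter> F y \<noteq> {}" "p $ c = a y $ c" using corner[OF \<open>v \<in> I\<close>] by blast
      then obtain x where "x \<in> cbox (a v) (b v)" "x \<in> cbox (a y) (b y)"
        using F \<open>v \<in> I\<close> \<open>I \<subseteq> V\<close> by blast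
      then show ?thesis
        using \<open>p $ c = a y $ c\<close> by (force simp: mem_box_cart intro: order_trans)
    qed
    then show ?thesis using F that \<open>I \<subseteq> V\<close> corner[OF that] by (auto simp: mem_box_cart)
  qed
  then show ?thesis by blast
qed

lemma open_boxes_common_point:
  fixes a b :: "nat \<Rightarrow> real ^ 'd::finite"
  assumes F: "\<And>i. i \<in> V \<Longrightarrow> F i = box (a i) (b i)" and "I \<subseteq> V" and "finite I"
    and corner: "\<And>v c. v \<in> I \<Longrightarrow> a v $ c \<le> p $ c \<and> (\<exists>y\<in>V. F v \<inter> F y \<noteq> {} \<and> p $ c = a y $ c)"
  shows "\<exists>x. \<forall>v\<in>I. x \<in> F v"
proof -
  have below: "p $ c < b v $ c" if "v \<in> I" for v c
  proof -
    obtain y where "y \<in> V" "F v \<inter> F y \<noteq> {}" "p $ c = a y $ c" using corner[OF \<open>v \<in> I\<close>] by blast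
    then obtain x where "x \<in> box (a v) (b v)" "x \<in> box (a y) (b y)"
      using F \<open>v \<in> I\<close> \<open>I \<subseteq> V\<close> by blast
    then show ?thesis
      using \<open>p $ c = a y $ c\<close> by (force simp: mem_box_cart intro: less_trans)
  qed
  have "\<exists>t>p $ c. \<forall>v\<in>I. t < b v $ c" for c
  proof -
    have "p $ c < Min (insert (p $ c + 1) ((\<lambda>v. b v $ c) ` I))"
      using \<open>finite I\<close> below by (subst Min_gr_iff) auto
    from dense[OF this] show ?thesis using \<open>finite I\<close> by (auto simp: Min_gr_iff)
  qed
  then obtain t where t: "\<And>c. p $ c < t c" "\<And>c v. v \<in> I \<Longrightarrow> t c < b v $ c" by metis
  have "(\<chi> c. t c) \<in> F v" if "v \<in> I" for v
  proof -
    have "a v $ c < t c" for c using corner[OF that, of c] t(1)[of c] by linarith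
    then have "(\<chi> c. t c) \<in> box (a v) (b v)" using t(2)[OF that] by (simp add: mem_box_cart)
    then show ?thesis using F that \<open>I \<subseteq> V\<close> by blast
  qed
  then show ?thesis by blast
qed

theorem mainTheorem1:
  fixes \<alpha> :: real
  assumes "1 - 1 / real CARD('d::finite) < \<alpha>" and "\<alpha> \<le> 1"
  shows "\<exists>\<beta>>0. \<forall>n>0. \<forall>F :: nat \<Rightarrow> (real ^ 'd) set.
           box_family n F \<longrightarrow>
           real (card (intersecting_pairs n F)) \<ge> \<alpha> * real (n choose 2) \<longrightarrow>
           (\<exists>I. intersecting_subfamily n F I \<and> real (card I) \<ge> \<beta> * real n)"
proof -
  let ?d = "CARD('d)"
  define q where "q = 1 - \<alpha>"
  define \<delta> where "\<delta> = (\<Prod>j=1..?d. 1 - real j * q)"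
  have q: "0 \<le> q" "real ?d * q < 1" using assms by (simp_all add: q_def field_simps)
  have "0 < 1 - real j * q" if "j \<in> {1..?d}" for j
    using that q mult_right_mono[of "real j" "real ?d" q] by simp
  then have "\<delta> > 0" unfolding \<delta>_def by (rule prod_pos)
  have main: "\<exists>I. intersecting_subfamily n F I \<and> real (card I) \<ge> \<delta> / real (Suc ?d) * real n"
    if "n > 0" and boxes: "box_family n F"
      and dense: "real (card (intersecting_pairs n F)) \<ge> \<alpha> * real (n choose 2)"
    for n and F :: "nat \<Rightarrow> (real ^ 'd) set"
  proof -
    have "\<exists>a b. (\<forall>i<n. \<forall>c. a i $ c < b i $ c) \<and>
        ((\<forall>i<n. F i = box (a i) (b i)) \<or> (\<forall>i<n. F i = cbox (a i) (b i)))"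
      using boxes unfolding box_family_def open_box_def closed_box_def by metis
    then obtain a b where less: "\<And>i c. i < n \<Longrightarrow> a i $ c < b i $ c"
      and F: "(\<forall>i<n. F i = box (a i) (b i)) \<or> (\<forall>i<n. F i = cbox (a i) (b i))" by blast
    have nonempty: "F i \<noteq> {}" if "i < n" for i
    proof -
      have "box (a i) (b i) \<noteq> {}" using less[OF that] by (simp add: interval_ne_empty_cart)
      then show ?thesis using F that box_subset_cbox[of "a i" "b i"] by auto
    qed
    interpret finite_tolerance "{..<n}" "\<lambda>i j. F i \<inter> F j \<noteq> {}"
      by unfold_locales (use nonempty \<open>n > 0\<close> in auto)
    have "cliques 2 = (\<lambda>(i, j). [i, j]) ` {(i, j). i < n \<and> j < n \<and> F i \<inter> F j \<noteq> {}}"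
      using nonempty by (auto simp: cliques_def length_Suc_conv numeral_2_eq_2 image_iff)
    then have "card (cliques 2) = card {(i, j). i < n \<and> j < n \<and> F i \<inter> F j \<noteq> {}}"
      by (simp add: card_image inj_on_def)
    then have "(1 - q) * (real (card {..<n}))\<^sup>2 \<le> card (cliques 2)"
      using intersecting_ordered_pairs[OF nonempty \<open>\<alpha> \<le> 1\<close> dense] by (simp add: q_def)
    from card_cliques_ge[OF this q(2,1)]
    have "\<delta> * real (card {..<n}) ^ Suc ?d \<le> card (cliques (Suc ?d))" by (simp add: \<delta>_def)
    from heavily_charged_corner[OF this, of a]
    obtain I p where I: "I \<subseteq> {..<n}" "\<delta> / real (Suc ?d) * real n \<le> card I"
      and corner: "\<And>v c. v \<in> I \<Longrightarrow>
        a v $ c \<le> p $ c \<and> (\<exists>y\<in>{..<n}. F v \<inter> F y \<noteq> {} \<and> p $ c = a y $ c)"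
      unfolding card_lessThan by blast
    have "\<exists>x. \<forall>v\<in>I. x \<in> F v"
      using F
    proof
      assume "\<forall>i<n. F i = box (a i) (b i)"
      then show ?thesis
        using I(1) corner finite_subset[OF I(1)]
        by (intro open_boxes_common_point[of "{..<n}" F a b I p]) auto
    next
      assume "\<forall>i<n. F i = cbox (a i) (b i)"
      then show ?thesis
        using I(1) corner by (intro closed_boxes_common_point[of "{..<n}" F a b I p]) auto
    qed
    with I show ?thesis by (auto simp: intersecting_subfamily_def)
  qed
  have "\<delta> / real (Suc ?d) > 0" using \<open>\<delta> > 0\<close> by simp
  with main show ?thesis by blast
qed

end
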